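(* Suppose $G$ is a locally compact, Hausdorff and principal groupoid which admits a Haar system, and let $q:G^{(0)}\to G^{(0)}/G$ be the quotient map onto the orbit space. Then $G$ is Cartan if and only if the map $r\times s:\gamma\mapsto (r(\gamma),s(\gamma))$ is a topological isomorphism (an isomorphism of topological groupoids) of $G$ onto $R(q)$.
   Context: $G$ is a topological groupoid with unit space $G^{(0)}$, range map $r$ and source map $s$. $G$ is principal if there is at most one morphism between each pair of units. $G$ is Cartan if every $u\in G^{(0)}$ has a neighbourhood $N$ in $G^{(0)}$ such that $s^{-1}(N)\cap r^{-1}(N)$ has compact closure in $G$. The orbit of $u\in G^{(0)}$ is $[u]=r(s^{-1}(u))$; $G^{(0)}/G$ is the set of orbits with the quotient topology and $q(u)=[u]$. A (left) Haar system on $G$ is a family $\{\lambda^u:u\in G^{(0)}\}$ of Radon measures on $G$ with $\operatorname{supp}\lambda^u=r^{-1}(u)$, such that $u\mapsto\int f\,d\lambda^u$ is continuous for every $f\in C_c(G)$ and $\int f(\gamma\beta)\,d\lambda^{s(\gamma)}(\beta)=\int f(\beta)\,d\lambda^{r(\gamma)}(\beta)$ for $f\in C_c(G)$, $\gamma\in G$. For a surjection $\psi$ from a topological space $Y$ to a set $X$, $R(\psi)=\{(y,z)\in Y\times Y:\psi(y)=\psi(z)\}$ with the subspace topology from $Y\times Y$ and the operations $r(y,z)=y$, $s(y,z)=z$, $(x,y)(y,z)=(x,z)$; here $Y=G^{(0)}$ and $\psi=q$. *)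

theory Defs
  imports "HOL-Analysis.Analysis"
begin

section \<open>Topological groupoids\<close>

text \<open>
  A groupoid has a space of morphisms and a separate unit space; the unit space is identified with
  a subspace of the morphisms along \<open>ident\<close>, which the axioms below force to be an embedding.
  Morphisms compose as \<open>cmp G \<gamma> \<beta> = \<gamma>\<beta>\<close>, meaningful only if \<open>src G \<gamma> = rng G \<beta>\<close>.
\<close>

record ('a, 'u) groupoid_data =
  arrows :: "'a topology"
  units  :: "'u topology"
  rng    :: "'a \<Rightarrow> 'u"
  src    :: "'a \<Rightarrow> 'u"
  ident  :: "'u \<Rightarrow> 'a"
  cmp    :: "'a \<Rightarrow> 'a \<Rightarrow> 'a"
  invs   :: "'a \<Rightarrow> 'a"

definition composable :: "('a, 'u, 'm) groupoid_data_scheme \<Rightarrow> ('a \<times> 'a) set" where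
  "composable G =
     {(\<gamma>, \<beta>). \<gamma> \<in> topspace (arrows G) \<and> \<beta> \<in> topspace (arrows G) \<and> src G \<gamma> = rng G \<beta>}"

locale topological_groupoid =
  fixes G :: "('a, 'u, 'm) groupoid_data_scheme"
  assumes continuous_rng: "continuous_map (arrows G) (units G) (rng G)"
    and continuous_src: "continuous_map (arrows G) (units G) (src G)"
    and continuous_ident: "continuous_map (units G) (arrows G) (ident G)"
    and continuous_cmp: "continuous_map
          (subtopology (prod_topology (arrows G) (arrows G)) (composable G)) (arrows G)
          (\<lambda>(\<gamma>, \<beta>). cmp G \<gamma> \<beta>)"
    and continuous_invs: "continuous_map (arrows G) (arrows G) (invs G)"
    and rng_ident: "u \<in> topspace (units G) \<Longrightarrow> rng G (ident G u) = u"
    and src_ident: "u \<in> topspace (units G) \<Longrightarrow> src G (ident G u) = u"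
    and rng_cmp: "(\<gamma>, \<beta>) \<in> composable G \<Longrightarrow> rng G (cmp G \<gamma> \<beta>) = rng G \<gamma>"
    and src_cmp: "(\<gamma>, \<beta>) \<in> composable G \<Longrightarrow> src G (cmp G \<gamma> \<beta>) = src G \<beta>"
    and rng_invs: "\<gamma> \<in> topspace (arrows G) \<Longrightarrow> rng G (invs G \<gamma>) = src G \<gamma>"
    and src_invs: "\<gamma> \<in> topspace (arrows G) \<Longrightarrow> src G (invs G \<gamma>) = rng G \<gamma>"
    and cmp_assoc: "(\<alpha>, \<beta>) \<in> composable G \<Longrightarrow> (\<beta>, \<gamma>) \<in> composable G \<Longrightarrow>
          cmp G (cmp G \<alpha> \<beta>) \<gamma> = cmp G \<alpha> (cmp G \<beta> \<gamma>)"
    and ident_cmp: "\<gamma> \<in> topspace (arrows G) \<Longrightarrow> cmp G (ident G (rng G \<gamma>)) \<gamma> = \<gamma>"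
    and cmp_ident: "\<gamma> \<in> topspace (arrows G) \<Longrightarrow> cmp G \<gamma> (ident G (src G \<gamma>)) = \<gamma>"
    and cmp_invs: "\<gamma> \<in> topspace (arrows G) \<Longrightarrow> cmp G \<gamma> (invs G \<gamma>) = ident G (rng G \<gamma>)"
    and invs_cmp: "\<gamma> \<in> topspace (arrows G) \<Longrightarrow> cmp G (invs G \<gamma>) \<gamma> = ident G (src G \<gamma>)"

definition principal_groupoid :: "('a, 'u, 'm) groupoid_data_scheme \<Rightarrow> bool" where
  "principal_groupoid G \<longleftrightarrow> (\<forall>\<gamma>\<in>topspace (arrows G). \<forall>\<beta>\<in>topspace (arrows G).
     rng G \<gamma> = rng G \<beta> \<and> src G \<gamma> = src G \<beta> \<longrightarrow> \<gamma> = \<beta>)"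

text \<open>Neighbourhoods are not required to be open.\<close>

definition cartan_groupoid :: "('a, 'u, 'm) groupoid_data_scheme \<Rightarrow> bool" where
  "cartan_groupoid G \<longleftrightarrow> (\<forall>u\<in>topspace (units G). \<exists>N\<subseteq>topspace (units G).
     (\<exists>U. openin (units G) U \<and> u \<in> U \<and> U \<subseteq> N) \<and>
     compactin (arrows G)
       (arrows G closure_of {\<gamma> \<in> topspace (arrows G). src G \<gamma> \<in> N \<and> rng G \<gamma> \<in> N}))"

definition orbit :: "('a, 'u, 'm) groupoid_data_scheme \<Rightarrow> 'u \<Rightarrow> 'u set" where
  "orbit G u = rng G ` {\<gamma> \<in> topspace (arrows G). src G \<gamma> = u}"

definition groupoid_hom ::
  "('a, 'u, 'm) groupoid_data_scheme \<Rightarrow> ('b, 'v, 'n) groupoid_data_scheme \<Rightarrow> ('a \<Rightarrow> 'b) \<Rightarrow> bool" where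
  "groupoid_hom G H \<phi> \<longleftrightarrow>
     (\<forall>\<gamma>\<in>topspace (arrows G). \<phi> \<gamma> \<in> topspace (arrows H)) \<and>
     (\<forall>(\<gamma>, \<beta>)\<in>composable G. (\<phi> \<gamma>, \<phi> \<beta>) \<in> composable H \<and> \<phi> (cmp G \<gamma> \<beta>) = cmp H (\<phi> \<gamma>) (\<phi> \<beta>))"

definition topological_groupoid_iso ::
  "('a, 'u, 'm) groupoid_data_scheme \<Rightarrow> ('b, 'v, 'n) groupoid_data_scheme \<Rightarrow> ('a \<Rightarrow> 'b) \<Rightarrow> bool" where
  "topological_groupoid_iso G H \<phi> \<longleftrightarrow>
     (\<exists>\<theta>. homeomorphic_maps (arrows G) (arrows H) \<phi> \<theta> \<and> groupoid_hom G H \<phi> \<and> groupoid_hom H G \<theta>)"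

section \<open>The groupoid of a map\<close>

definition kernel_groupoid :: "'y topology \<Rightarrow> ('y \<Rightarrow> 'x) \<Rightarrow> ('y \<times> 'y, 'y) groupoid_data" where
  "kernel_groupoid Y \<psi> =
     \<lparr>arrows = subtopology (prod_topology Y Y)
                 {(y, z). y \<in> topspace Y \<and> z \<in> topspace Y \<and> \<psi> y = \<psi> z},
      units = Y,
      rng = fst,
      src = snd,
      ident = (\<lambda>y. (y, y)),
      cmp = (\<lambda>p p'. (fst p, snd p')),
      invs = (\<lambda>p. (snd p, fst p))\<rparr>"

lemma topological_groupoid_kernel_groupoid:
  fixes Y :: "'a topology"
  shows "topological_groupoid (kernel_groupoid Y \<psi>)"
proof -
  let ?R = "subtopology (prod_topology Y Y)
              {(y, z). y \<in> topspace Y \<and> z \<in> topspace Y \<and> \<psi> y = \<psi> z}"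
  have c1: "continuous_map ?R Y fst" and c2: "continuous_map ?R Y snd"
    by (auto intro: continuous_map_from_subtopology continuous_map_fst continuous_map_snd)
  have c3: "continuous_map Y ?R (\<lambda>y. (y, y))"
    by (auto simp: continuous_map_in_subtopology continuous_map_paired)
  have c4: "continuous_map (subtopology (prod_topology ?R ?R) C) ?R
              (\<lambda>p. (fst (fst p), snd (snd p)))"
    if "C \<subseteq> {(\<gamma>, \<beta>). snd \<gamma> = fst \<beta>}" for C
  proof -
    have "continuous_map (subtopology (prod_topology ?R ?R) C) Y (\<lambda>p. fst (fst p))"
      using continuous_map_compose[OF continuous_map_from_subtopology[OF continuous_map_fst] c1]
      by (simp add: o_def)
    moreover have "continuous_map (subtopology (prod_topology ?R ?R) C) Y (\<lambda>p. snd (snd p))"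
      using continuous_map_compose[OF continuous_map_from_subtopology[OF continuous_map_snd] c2]
      by (simp add: o_def)
    ultimately have "continuous_map (subtopology (prod_topology ?R ?R) C) (prod_topology Y Y)
        (\<lambda>p. (fst (fst p), snd (snd p)))"
      by (simp add: continuous_map_paired)
    moreover have "(\<lambda>p. (fst (fst p), snd (snd p))) \<in> topspace (subtopology (prod_topology ?R ?R) C)
        \<rightarrow> {(y, z). y \<in> topspace Y \<and> z \<in> topspace Y \<and> \<psi> y = \<psi> z}"
      using that by auto
    ultimately show ?thesis
      by (simp add: continuous_map_in_subtopology image_subset_iff_funcset)
  qed
  have c5: "continuous_map ?R ?R (\<lambda>p. (snd p, fst p))"
    using c1 c2 by (auto simp: continuous_map_in_subtopology continuous_map_paired case_prod_beta)
  show ?thesis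
  proof
    show "continuous_map
        (subtopology (prod_topology (arrows (kernel_groupoid Y \<psi>)) (arrows (kernel_groupoid Y \<psi>)))
          (composable (kernel_groupoid Y \<psi>)))
        (arrows (kernel_groupoid Y \<psi>)) (\<lambda>(\<gamma>, \<beta>). cmp (kernel_groupoid Y \<psi>) \<gamma> \<beta>)"
      using c4[of "composable (kernel_groupoid Y \<psi>)"]
      by (auto simp: kernel_groupoid_def composable_def case_prod_beta')
  qed (use c1 c2 c3 c5 in \<open>auto simp: kernel_groupoid_def composable_def\<close>)
qed

section \<open>Haar systems\<close>

definition borel_of :: "'a topology \<Rightarrow> 'a measure" where
  "borel_of X = sigma (topspace X) {U. openin X U}"

definition radon_measure :: "'a topology \<Rightarrow> 'a measure \<Rightarrow> bool" where
  "radon_measure X M \<longleftrightarrow>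
     sets M = sets (borel_of X) \<and>
     (\<forall>K. compactin X K \<longrightarrow> emeasure M K < \<infinity>) \<and>
     (\<forall>B\<in>sets M. emeasure M B = (INF U\<in>{U. openin X U \<and> B \<subseteq> U}. emeasure M U)) \<and>
     (\<forall>U. openin X U \<longrightarrow> emeasure M U = (SUP K\<in>{K. compactin X K \<and> K \<subseteq> U}. emeasure M K))"

definition measure_support :: "'a topology \<Rightarrow> 'a measure \<Rightarrow> 'a set" where
  "measure_support X M = {x \<in> topspace X. \<forall>U. openin X U \<and> x \<in> U \<longrightarrow> emeasure M U \<noteq> 0}"

definition compactly_supported :: "'a topology \<Rightarrow> ('a \<Rightarrow> complex) set" where
  "compactly_supported X =
     {f. continuous_map X euclidean f \<and> compactin X (X closure_of {x \<in> topspace X. f x \<noteq> 0})}"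

text \<open>
  In the invariance condition, the product \<open>\<gamma>\<beta>\<close> is only defined for \<open>\<beta>\<close> with \<open>rng G \<beta> = src G \<gamma>\<close>,
  so the left-hand integral is restricted to these \<open>\<beta>\<close>; they carry the measure \<open>\<mu> (src G \<gamma>)\<close>.
\<close>

definition haar_system ::
  "('a, 'u, 'm) groupoid_data_scheme \<Rightarrow> ('u \<Rightarrow> 'a measure) \<Rightarrow> bool" where
  "haar_system G \<mu> \<longleftrightarrow>
     (\<forall>u\<in>topspace (units G).
        radon_measure (arrows G) (\<mu> u) \<and>
        measure_support (arrows G) (\<mu> u) = {\<gamma> \<in> topspace (arrows G). rng G \<gamma> = u}) \<and>
     (\<forall>f\<in>compactly_supported (arrows G).
        continuous_map (units G) euclidean (\<lambda>u. LINT \<beta>|\<mu> u. f \<beta>)) \<and>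
     (\<forall>f\<in>compactly_supported (arrows G). \<forall>\<gamma>\<in>topspace (arrows G).
        (LINT \<beta>:{\<beta> \<in> topspace (arrows G). rng G \<beta> = src G \<gamma>}|\<mu> (src G \<gamma>). f (cmp G \<gamma> \<beta>)) =
        (LINT \<beta>|\<mu> (rng G \<gamma>). f \<beta>))"

end

theory Submission
  imports Defs
begin

text \<open>
  Since \<open>G\<close> is principal, \<open>r \<times> s\<close> is always a continuous bijective homomorphism of \<open>G\<close> onto
  \<open>R(q)\<close>: two units lie in the same orbit exactly when some arrow joins them.  The
  question is therefore only whether it is open.

  If it is open, take a compact neighbourhood \<open>K\<close> of a unit arrow.  The image of the interior of
  \<open>K\<close> contains a basic neighbourhood \<open>R(q) \<inter> (N \<times> N)\<close> of a diagonal point, so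
  all arrows with both ends in \<open>N\<close> lie in \<open>K\<close>, and \<open>G\<close> is Cartan.

  Conversely, let \<open>G\<close> be Cartan.  Compactness first gives openness of \<open>r \<times> s\<close> at the
  unit arrows: arrows whose two ends are both close to \<open>u\<close> are close to the unit
  arrow at \<open>u\<close> (\<open>arrow_near_ident\<close>).  To pass to an arbitrary arrow \<open>\<gamma>\<close>, let
  \<open>\<delta>\<close> have its ends close to those of \<open>\<gamma>\<close>.  The range map is open
  (\<open>haar_system_imp_open_map_rng\<close>: integrating a bump function against a Haar system gives a
  continuous function on the units that is nonzero only on ranges of arrows in the support of the
  bump), hence so is the source map, and there is \<open>\<beta>\<close> close to \<open>\<gamma>\<close> with the same
  source as \<open>\<delta>\<close>.  Then \<open>\<delta>\<beta>\<inverse>\<close> has both ends close to \<open>r(\<gamma>)\<close>, so it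
  is close to a unit arrow, and \<open>\<delta> = (\<delta>\<beta>\<inverse>)\<beta>\<close> is close to \<open>\<gamma>\<close>.
\<close>

lemma openin_prod_topologyE:
  assumes "openin (prod_topology X Y) T" "(x, y) \<in> T"
  obtains U V where "openin X U" "openin Y V" "x \<in> U" "y \<in> V" "U \<times> V \<subseteq> T"
proof -
  have "\<exists>U V. openin X U \<and> openin Y V \<and> x \<in> U \<and> y \<in> V \<and> U \<times> V \<subseteq> T"
    by (rule iffD1[OF openin_prod_topology_alt assms(1), rule_format, OF assms(2)])
  then show ?thesis
    by (elim exE conjE) (rule that)
qed

section \<open>Radon measures and bump functions\<close>

lemma radon_measure_space:
  assumes "radon_measure X M"
  shows "space M = topspace X"
proof -
  have "sets M = sets (borel_of X)"
    using assms by (simp add: radon_measure_def)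
  then have "space M = space (borel_of X)"
    by (rule sets_eq_imp_space_eq)
  then show ?thesis
    using openin_subset by (force simp: borel_of_def space_measure_of_conv)
qed

lemma radon_measure_openin_sets:
  assumes "radon_measure X M" "openin X U"
  shows "U \<in> sets M"
proof -
  have "{U. openin X U} \<subseteq> Pow (topspace X)"
    using openin_subset by blast
  then show ?thesis
    using assms by (auto simp: radon_measure_def borel_of_def sets_measure_of)
qed

lemma radon_measure_closedin_sets:
  assumes "radon_measure X M" "closedin X C"
  shows "C \<in> sets M"
proof -
  have "topspace X - C \<in> sets M"
    using assms by (auto intro: radon_measure_openin_sets)
  then have "space M - (topspace X - C) \<in> sets M"
    by blast
  moreover have "space M - (topspace X - C) = C"
    using closedin_subset[OF assms(2)] by (auto simp: radon_measure_space[OF assms(1)])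
  ultimately show ?thesis by simp
qed

lemma radon_measure_continuous_measurable:
  fixes f :: "'a \<Rightarrow> 'b::topological_space"
  assumes M: "radon_measure X M" and f: "continuous_map X euclidean f"
  shows "f \<in> borel_measurable M"
proof (rule borel_measurableI)
  fix S :: "'b set"
  assume "open S"
  then have "openin X {x \<in> topspace X. f x \<in> S}"
    using f by (auto intro: openin_continuous_map_preimage)
  moreover have "f -` S \<inter> space M = {x \<in> topspace X. f x \<in> S}"
    by (auto simp: radon_measure_space[OF M])
  ultimately show "f -` S \<inter> space M \<in> sets M"
    using M by (simp add: radon_measure_openin_sets)
qed

text \<open>
  The complement of the support need not be a countable union of null open sets.  Inner regularity
  helps: each compact subset of \<open>U\<close> is covered by finitely many of them.
\<close>

lemma radon_measure_null_off_support:
  assumes M: "radon_measure X M" and U: "openin X U"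
    and disj: "U \<inter> measure_support X M = {}"
  shows "emeasure M U = 0"
proof -
  have K0: "emeasure M K = 0" if K: "compactin X K" and KU: "K \<subseteq> U" for K
  proof -
    let ?N = "{V. openin X V \<and> emeasure M V = 0}"
    have "K \<subseteq> \<Union>?N"
    proof
      fix x assume x: "x \<in> K"
      then have "x \<in> topspace X" "x \<notin> measure_support X M"
        using disj KU U openin_subset by blast+
      then show "x \<in> \<Union>?N"
        unfolding measure_support_def by blast
    qed
    then obtain F where F: "finite F" "F \<subseteq> ?N" "K \<subseteq> \<Union>F"
      using K unfolding compactin_def by (metis (no_types, lifting) mem_Collect_eq subsetD)
    have "(\<Union>V\<in>F. V) \<in> null_sets M"
      using F M by (intro null_sets_UN') (auto simp: radon_measure_openin_sets
          countable_finite intro!: null_setsI)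
    moreover have "emeasure M K \<le> emeasure M (\<Union>V\<in>F. V)"
      using F(3) calculation by (intro emeasure_mono) auto
    ultimately show ?thesis by auto
  qed
  have "emeasure M U = (SUP K\<in>{K. compactin X K \<and> K \<subseteq> U}. emeasure M K)"
    using M U by (simp add: radon_measure_def)
  also have "\<dots> \<le> 0"
    using K0 by (intro SUP_least) auto
  finally show ?thesis by simp
qed

lemma bump_function_exists:
  assumes lc: "locally_compact_space X" and hd: "Hausdorff_space X"
    and U: "openin X U" and x: "x \<in> U"
  obtains g :: "'a \<Rightarrow> real"
  where "continuous_map X euclidean g" "g x = 1" "\<And>y. y \<in> topspace X \<Longrightarrow> 0 \<le> g y \<and> g y \<le> 1"
    "\<And>y. y \<in> topspace X - U \<Longrightarrow> g y = 0"
    "compactin X (X closure_of {y \<in> topspace X. g y \<noteq> 0})"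
proof -
  have xX: "x \<in> topspace X"
    using U x openin_subset by blast
  obtain V K where V: "openin X V" "compactin X K" "x \<in> V" "V \<subseteq> K"
    using lc xX unfolding locally_compact_space_def by blast
  have "completely_regular_space X"
    using lc hd locally_compact_regular_imp_completely_regular_space by blast
  moreover have "closedin X (topspace X - U \<inter> V)"
    using U V by blast
  moreover have "x \<in> topspace X - (topspace X - U \<inter> V)"
    using x V xX by blast
  ultimately obtain f :: "'a \<Rightarrow> real"
    where f: "continuous_map X (top_of_set {0..1}) f" "f x = 0" "f ` (topspace X - U \<inter> V) \<subseteq> {1}"
    unfolding completely_regular_space_def by metis
  have fc: "continuous_map X euclidean f" and f01: "\<And>y. y \<in> topspace X \<Longrightarrow> f y \<in> {0..1}"
    using f(1) by (auto simp: continuous_map_in_subtopology Pi_iff image_subset_iff)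
  show ?thesis
  proof
    show "continuous_map X euclidean (\<lambda>y. 1 - f y)"
      using fc by (intro continuous_intros)
    show "1 - f x = 1"
      using f by simp
    show "0 \<le> 1 - f y \<and> 1 - f y \<le> 1" if "y \<in> topspace X" for y
      using f01[OF that] by simp
    show "1 - f y = 0" if "y \<in> topspace X - U" for y
      using f(3) that by force
    have "{y \<in> topspace X. 1 - f y \<noteq> 0} \<subseteq> K"
      using f(3) V(4) by force
    then have "X closure_of {y \<in> topspace X. 1 - f y \<noteq> 0} \<subseteq> K"
      using V(2) hd compactin_imp_closedin by (intro closure_of_minimal) auto
    then show "compactin X (X closure_of {y \<in> topspace X. 1 - f y \<noteq> 0})"
      using V(2) by (rule_tac closed_compactin) auto
  qed
qed

lemma radon_measure_integral_bump_nonzero: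
  fixes g :: "'a \<Rightarrow> real"
  assumes M: "radon_measure X M" and g: "continuous_map X euclidean g"
    and nonneg: "\<And>y. y \<in> topspace X \<Longrightarrow> 0 \<le> g y \<and> g y \<le> 1"
    and cpt: "compactin X (X closure_of {y \<in> topspace X. g y \<noteq> 0})"
    and x: "x \<in> measure_support X M" "g x = 1"
  shows "(LINT y|M. g y) \<noteq> 0"
proof
  assume zero: "(LINT y|M. g y) = 0"
  let ?C = "X closure_of {y \<in> topspace X. g y \<noteq> 0}"
  have sub: "{y \<in> topspace X. g y \<noteq> 0} \<subseteq> ?C"
    by (intro closure_of_subset) auto
  have meas: "g \<in> borel_measurable M"
    using M g by (rule radon_measure_continuous_measurable)
  have "integrable M g"
  proof (rule integrableI_bounded_set)
    show "?C \<in> sets M"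
      using M by (simp add: radon_measure_closedin_sets)
    show "emeasure M ?C < \<infinity>"
      using M cpt by (simp add: radon_measure_def)
    show "AE y in M. y \<in> ?C \<longrightarrow> norm (g y) \<le> 1"
      using nonneg by (intro AE_I2) (auto simp: radon_measure_space[OF M])
    show "AE y in M. y \<notin> ?C \<longrightarrow> g y = 0"
      using sub by (intro AE_I2) (auto simp: radon_measure_space[OF M])
  qed (fact meas)
  moreover have "AE y in M. 0 \<le> g y"
    using nonneg by (intro AE_I2) (auto simp: radon_measure_space[OF M])
  ultimately have "AE y in M. g y = 0"
    using zero integral_nonneg_eq_0_iff_AE by blast
  moreover have op: "openin X {y \<in> topspace X. g y \<in> - {0}}"
    using g by (intro openin_continuous_map_preimage) auto
  ultimately have "emeasure M {y \<in> topspace X. g y \<in> - {0}} = 0"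
    using radon_measure_openin_sets[OF M op]
    by (subst (asm) AE_iff_measurable[OF _ refl]) (auto simp: radon_measure_space[OF M])
  then show False
    using x op unfolding measure_support_def by auto
qed

section \<open>Openness of the range and source maps\<close>

text \<open>
  The integrals of a bump function supported in \<open>U\<close> form a continuous function of the unit; it does
  not vanish at the range of the centre of the bump, and vanishes at every unit that is not the
  range of an arrow in \<open>U\<close>.  So its nonvanishing set is a neighbourhood inside the image of \<open>U\<close>.
\<close>

lemma haar_system_imp_open_map_rng:
  assumes G: "topological_groupoid G"
    and lc: "locally_compact_space (arrows G)" and hd: "Hausdorff_space (arrows G)"
    and \<mu>: "haar_system G \<mu>"
  shows "open_map (arrows G) (units G) (rng G)"
  unfolding open_map_def
proof (intro allI impI)
  fix U assume U: "openin (arrows G) U"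
  interpret topological_groupoid G by fact
  have radon: "radon_measure (arrows G) (\<mu> u)"
    and supp: "measure_support (arrows G) (\<mu> u) = {\<gamma> \<in> topspace (arrows G). rng G \<gamma> = u}"
    if "u \<in> topspace (units G)" for u
    using \<mu> that unfolding haar_system_def by blast+
  show "openin (units G) (rng G ` U)"
  proof (subst openin_subopen, intro ballI)
    fix u assume "u \<in> rng G ` U"
    then obtain \<gamma> where \<gamma>: "\<gamma> \<in> U" "u = rng G \<gamma>" by blast
    then have \<gamma>G: "\<gamma> \<in> topspace (arrows G)"
      using U openin_subset by blast
    then have u: "u \<in> topspace (units G)"
      using \<gamma> continuous_map_funspace[OF continuous_rng] by auto
    obtain g :: "'a \<Rightarrow> real" where g: "continuous_map (arrows G) euclidean g" "g \<gamma> = 1"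
      "\<And>y. y \<in> topspace (arrows G) \<Longrightarrow> 0 \<le> g y \<and> g y \<le> 1"
      "\<And>y. y \<in> topspace (arrows G) - U \<Longrightarrow> g y = 0"
      "compactin (arrows G) (arrows G closure_of {y \<in> topspace (arrows G). g y \<noteq> 0})"
      by (rule bump_function_exists[OF lc hd U \<gamma>(1)]) blast
    let ?f = "\<lambda>y. complex_of_real (g y)"
    let ?I = "\<lambda>v. LINT y|\<mu> v. ?f y"
    have "continuous_map (arrows G) euclidean ?f"
      using continuous_map_compose[OF g(1), of euclidean complex_of_real]
      by (simp add: o_def continuous_on_of_real)
    then have "?f \<in> compactly_supported (arrows G)"
      using g(5) by (simp add: compactly_supported_def)
    then have "continuous_map (units G) euclidean ?I"
      using \<mu> unfolding haar_system_def by blast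
    then have op: "openin (units G) {v \<in> topspace (units G). ?I v \<in> - {0}}"
      by (intro openin_continuous_map_preimage) auto
    have "\<gamma> \<in> measure_support (arrows G) (\<mu> u)"
      using supp[OF u] \<gamma> \<gamma>G by simp
    then have "(LINT y|\<mu> u. g y) \<noteq> 0"
      using radon_measure_integral_bump_nonzero[OF radon[OF u] g(1) g(3) g(5)] g(2) by blast
    then have "u \<in> {v \<in> topspace (units G). ?I v \<in> - {0}}"
      using u by simp
    moreover have "{v \<in> topspace (units G). ?I v \<in> - {0}} \<subseteq> rng G ` U"
    proof
      fix v assume v: "v \<in> {v \<in> topspace (units G). ?I v \<in> - {0}}"
      show "v \<in> rng G ` U"
      proof (rule ccontr)
        assume "v \<notin> rng G ` U"
        then have "U \<inter> measure_support (arrows G) (\<mu> v) = {}"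
          using supp v by auto
        then have "U \<in> null_sets (\<mu> v)"
          using radon_measure_null_off_support[OF radon U, of v]
            radon_measure_openin_sets[OF radon U, of v] v by (auto intro: null_setsI)
        then have "AE y in \<mu> v. ?f y = 0"
          using g(4) v by (elim AE_I') (auto simp: radon_measure_space[OF radon])
        then have "?I v = 0"
          by (rule integral_eq_zero_AE)
        with v show False by simp
      qed
    qed
    ultimately show "\<exists>T. openin (units G) T \<and> u \<in> T \<and> T \<subseteq> rng G ` U"
      using op by blast
  qed
qed

context topological_groupoid
begin

lemma rng_in_units: "\<gamma> \<in> topspace (arrows G) \<Longrightarrow> rng G \<gamma> \<in> topspace (units G)"
  using continuous_map_funspace[OF continuous_rng] by auto

lemma src_in_units: "\<gamma> \<in> topspace (arrows G) \<Longrightarrow> src G \<gamma> \<in> topspace (units G)"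
  using continuous_map_funspace[OF continuous_src] by auto

lemma ident_in_arrows: "u \<in> topspace (units G) \<Longrightarrow> ident G u \<in> topspace (arrows G)"
  using continuous_map_funspace[OF continuous_ident] by auto

lemma invs_in_arrows: "\<gamma> \<in> topspace (arrows G) \<Longrightarrow> invs G \<gamma> \<in> topspace (arrows G)"
  using continuous_map_funspace[OF continuous_invs] by auto

lemma cmp_in_arrows: "(\<gamma>, \<beta>) \<in> composable G \<Longrightarrow> cmp G \<gamma> \<beta> \<in> topspace (arrows G)"
  using continuous_map_funspace[OF continuous_cmp] by (force simp: composable_def)

lemma invs_invs:
  assumes \<gamma>: "\<gamma> \<in> topspace (arrows G)"
  shows "invs G (invs G \<gamma>) = \<gamma>"
proof -
  let ?i = "invs G \<gamma>" and ?j = "invs G (invs G \<gamma>)"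
  have i: "?i \<in> topspace (arrows G)" and j: "?j \<in> topspace (arrows G)"
    using \<gamma> by (simp_all add: invs_in_arrows)
  have "cmp G (cmp G \<gamma> ?i) ?j = cmp G \<gamma> (cmp G ?i ?j)"
    using \<gamma> i j by (intro cmp_assoc) (auto simp: composable_def rng_invs src_invs)
  moreover have "cmp G (cmp G \<gamma> ?i) ?j = ?j"
    using \<gamma> i j ident_cmp[OF j] by (simp add: cmp_invs rng_invs src_invs)
  moreover have "cmp G \<gamma> (cmp G ?i ?j) = \<gamma>"
    using \<gamma> i cmp_ident[OF \<gamma>] by (simp add: cmp_invs rng_invs)
  ultimately show ?thesis by simp
qed

text \<open>Inversion is an involutive homeomorphism that exchanges ranges and sources.\<close>

lemma open_map_src:
  assumes "open_map (arrows G) (units G) (rng G)"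
  shows "open_map (arrows G) (units G) (src G)"
  unfolding open_map_def
proof (intro allI impI)
  fix U assume U: "openin (arrows G) U"
  let ?V = "{\<gamma> \<in> topspace (arrows G). invs G \<gamma> \<in> U}"
  have "src G ` U = rng G ` ?V"
  proof (intro subset_antisym subsetI)
    fix u assume "u \<in> src G ` U"
    then obtain \<gamma> where "\<gamma> \<in> U" "u = src G \<gamma>" by blast
    moreover have "\<gamma> \<in> topspace (arrows G)"
      using U openin_subset \<open>\<gamma> \<in> U\<close> by blast
    ultimately have "invs G \<gamma> \<in> ?V" "u = rng G (invs G \<gamma>)"
      by (simp_all add: invs_in_arrows invs_invs rng_invs)
    then show "u \<in> rng G ` ?V" by blast
  next
    fix u assume "u \<in> rng G ` ?V"
    then show "u \<in> src G ` U"
      by (force simp: src_invs)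
  qed
  moreover have "openin (arrows G) ?V"
    using continuous_invs U by (rule openin_continuous_map_preimage)
  ultimately show "openin (units G) (src G ` U)"
    using assms by (simp add: open_map_def)
qed

section \<open>The map onto the orbit equivalence relation\<close>

lemma orbit_eq_iff:
  assumes u: "u \<in> topspace (units G)" and v: "v \<in> topspace (units G)"
  shows "orbit G u = orbit G v \<longleftrightarrow> (\<exists>\<gamma>\<in>topspace (arrows G). rng G \<gamma> = u \<and> src G \<gamma> = v)"
proof
  assume "orbit G u = orbit G v"
  moreover have "u \<in> orbit G u"
    unfolding orbit_def using u
    by (auto simp: ident_in_arrows src_ident rng_ident intro!: rev_image_eqI[of "ident G u"])
  ultimately show "\<exists>\<gamma>\<in>topspace (arrows G). rng G \<gamma> = u \<and> src G \<gamma> = v"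
    unfolding orbit_def by auto
next
  have mono: "orbit G (rng G \<gamma>) \<subseteq> orbit G (src G \<gamma>)" if \<gamma>: "\<gamma> \<in> topspace (arrows G)" for \<gamma>
  proof
    fix w assume "w \<in> orbit G (rng G \<gamma>)"
    then obtain \<alpha> where \<alpha>: "\<alpha> \<in> topspace (arrows G)" "src G \<alpha> = rng G \<gamma>" "w = rng G \<alpha>"
      unfolding orbit_def by auto
    then have c: "(\<alpha>, \<gamma>) \<in> composable G"
      using \<gamma> by (simp add: composable_def)
    then show "w \<in> orbit G (src G \<gamma>)"
      unfolding orbit_def using \<alpha>
      by (auto simp: cmp_in_arrows src_cmp rng_cmp intro!: rev_image_eqI[of "cmp G \<alpha> \<gamma>"])
  qed
  assume "\<exists>\<gamma>\<in>topspace (arrows G). rng G \<gamma> = u \<and> src G \<gamma> = v"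
  then obtain \<gamma> where \<gamma>: "\<gamma> \<in> topspace (arrows G)" "rng G \<gamma> = u" "src G \<gamma> = v" by blast
  show "orbit G u = orbit G v"
    using mono[OF \<gamma>(1)] mono[OF invs_in_arrows[OF \<gamma>(1)]] \<gamma>
    by (simp add: rng_invs src_invs)
qed

lemma image_rng_src:
  "(\<lambda>\<gamma>. (rng G \<gamma>, src G \<gamma>)) ` topspace (arrows G)
    = topspace (arrows (kernel_groupoid (units G) (orbit G)))"
proof (intro subset_antisym subsetI)
  fix p assume "p \<in> (\<lambda>\<gamma>. (rng G \<gamma>, src G \<gamma>)) ` topspace (arrows G)"
  then show "p \<in> topspace (arrows (kernel_groupoid (units G) (orbit G)))"
    using orbit_eq_iff[OF rng_in_units src_in_units]
    by (force simp: kernel_groupoid_def rng_in_units src_in_units)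
next
  fix p assume p: "p \<in> topspace (arrows (kernel_groupoid (units G) (orbit G)))"
  then have "orbit G (fst p) = orbit G (snd p)" "fst p \<in> topspace (units G)"
    "snd p \<in> topspace (units G)"
    by (auto simp: kernel_groupoid_def)
  then obtain \<gamma> where "\<gamma> \<in> topspace (arrows G)" "rng G \<gamma> = fst p" "src G \<gamma> = snd p"
    using orbit_eq_iff by blast
  then show "p \<in> (\<lambda>\<gamma>. (rng G \<gamma>, src G \<gamma>)) ` topspace (arrows G)"
    by (auto intro!: rev_image_eqI[of \<gamma>])
qed

lemma continuous_map_rng_src:
  "continuous_map (arrows G) (prod_topology (units G) (units G)) (\<lambda>\<gamma>. (rng G \<gamma>, src G \<gamma>))"
  using continuous_rng continuous_src by (simp add: continuous_map_paired)

lemma groupoid_hom_rng_src: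
  "groupoid_hom G (kernel_groupoid (units G) (orbit G)) (\<lambda>\<gamma>. (rng G \<gamma>, src G \<gamma>))"
proof -
  have mem: "(rng G \<gamma>, src G \<gamma>) \<in> topspace (arrows (kernel_groupoid (units G) (orbit G)))"
    if "\<gamma> \<in> topspace (arrows G)" for \<gamma>
    using image_rng_src that by blast
  have "(rng G \<gamma>, src G \<gamma>) \<in> topspace (arrows (kernel_groupoid (units G) (orbit G))) \<and>
      (rng G \<beta>, src G \<beta>) \<in> topspace (arrows (kernel_groupoid (units G) (orbit G))) \<and>
      src G \<gamma> = rng G \<beta> \<and> rng G (cmp G \<gamma> \<beta>) = rng G \<gamma> \<and> src G (cmp G \<gamma> \<beta>) = src G \<beta>"
    if "(\<gamma>, \<beta>) \<in> composable G" for \<gamma> \<beta>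
    using that mem[of \<gamma>] mem[of \<beta>] rng_cmp[OF that] src_cmp[OF that]
    by (auto simp: composable_def)
  then show ?thesis
    using mem unfolding groupoid_hom_def
    by (auto simp: composable_def kernel_groupoid_def)
qed

lemma groupoid_hom_inverse:
  assumes hom: "groupoid_hom G H \<phi>"
    and \<theta>: "\<And>p. p \<in> topspace (arrows H) \<Longrightarrow> \<theta> p \<in> topspace (arrows G) \<and> \<phi> (\<theta> p) = p"
    and \<theta>\<phi>: "\<And>\<gamma>. \<gamma> \<in> topspace (arrows G) \<Longrightarrow> \<theta> (\<phi> \<gamma>) = \<gamma>"
    and comp: "\<And>\<gamma> \<beta>. \<gamma> \<in> topspace (arrows G) \<Longrightarrow> \<beta> \<in> topspace (arrows G) \<Longrightarrow>
      (\<phi> \<gamma>, \<phi> \<beta>) \<in> composable H \<Longrightarrow> (\<gamma>, \<beta>) \<in> composable G"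
  shows "groupoid_hom H G \<theta>"
  unfolding groupoid_hom_def
proof (intro conjI ballI, goal_cases)
  case (1 p)
  then show ?case using \<theta> by blast
next
  case (2 pq)
  obtain p q where pq: "pq = (p, q)" by (cases pq)
  then have p: "p \<in> topspace (arrows H)" and q: "q \<in> topspace (arrows H)"
    using 2 by (auto simp: composable_def)
  have c: "(\<theta> p, \<theta> q) \<in> composable G"
    using comp[of "\<theta> p" "\<theta> q"] \<theta>[OF p] \<theta>[OF q] 2 pq by simp
  then have "\<phi> (cmp G (\<theta> p) (\<theta> q)) = cmp H (\<phi> (\<theta> p)) (\<phi> (\<theta> q))"
    using hom unfolding groupoid_hom_def by fast
  then have "\<phi> (cmp G (\<theta> p) (\<theta> q)) = cmp H p q"
    using \<theta>[OF p] \<theta>[OF q] by simp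
  then have "cmp G (\<theta> p) (\<theta> q) = \<theta> (cmp H p q)"
    using \<theta>\<phi>[OF cmp_in_arrows[OF c]] by simp
  then show ?case
    using c pq by simp
qed

text \<open>The algebraic half of the isomorphism is automatic, so only the topology is at stake.\<close>

lemma topological_groupoid_iso_rng_src_iff:
  "topological_groupoid_iso G (kernel_groupoid (units G) (orbit G)) (\<lambda>\<gamma>. (rng G \<gamma>, src G \<gamma>))
    \<longleftrightarrow> homeomorphic_map (arrows G) (arrows (kernel_groupoid (units G) (orbit G)))
          (\<lambda>\<gamma>. (rng G \<gamma>, src G \<gamma>))"
    (is "topological_groupoid_iso G ?R ?\<phi> \<longleftrightarrow> _")
proof
  assume "topological_groupoid_iso G ?R ?\<phi>"
  then show "homeomorphic_map (arrows G) (arrows ?R) ?\<phi>"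
    unfolding topological_groupoid_iso_def homeomorphic_map_maps by blast
next
  assume "homeomorphic_map (arrows G) (arrows ?R) ?\<phi>"
  then obtain \<theta> where \<theta>: "homeomorphic_maps (arrows G) (arrows ?R) ?\<phi> \<theta>"
    unfolding homeomorphic_map_maps by blast
  have "groupoid_hom ?R G \<theta>"
  proof (rule groupoid_hom_inverse[OF groupoid_hom_rng_src])
    show "\<theta> p \<in> topspace (arrows G) \<and> ?\<phi> (\<theta> p) = p" if "p \<in> topspace (arrows ?R)" for p
    proof
      have "continuous_map (arrows ?R) (arrows G) \<theta>"
        using \<theta> unfolding homeomorphic_maps_def by blast
      from Pi_mem[OF continuous_map_funspace[OF this] that]
      show "\<theta> p \<in> topspace (arrows G)" .
      show "?\<phi> (\<theta> p) = p"
        using \<theta> that unfolding homeomorphic_maps_def by blast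
    qed
    show "\<theta> (?\<phi> \<gamma>) = \<gamma>" if "\<gamma> \<in> topspace (arrows G)" for \<gamma>
      using \<theta> that unfolding homeomorphic_maps_def by blast
  qed (auto simp: composable_def kernel_groupoid_def)
  then show "topological_groupoid_iso G ?R ?\<phi>"
    unfolding topological_groupoid_iso_def using \<theta> groupoid_hom_rng_src by blast
qed

section \<open>Cartan groupoids\<close>

lemma Hausdorff_units:
  assumes "Hausdorff_space (arrows G)"
  shows "Hausdorff_space (units G)"
  using assms continuous_ident
  by (rule Hausdorff_space_injective_preimage) (auto intro: inj_on_inverseI rng_ident)

text \<open>
  The arrows with both ends in a Cartan neighbourhood of \<open>u\<close> that avoid \<open>A\<close> lie in a compact set
  whose image under \<open>r \<times> s\<close> is closed.  By principality that image misses \<open>(u, u)\<close>, so the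
  neighbourhood can be shrunk until no such arrow remains.
\<close>

lemma arrow_near_ident:
  assumes hd: "Hausdorff_space (arrows G)" and pr: "principal_groupoid G"
    and ca: "cartan_groupoid G" and u: "u \<in> topspace (units G)"
    and A: "openin (arrows G) A" "ident G u \<in> A"
  obtains U where "openin (units G) U" "u \<in> U"
    "\<And>\<alpha>. \<alpha> \<in> topspace (arrows G) \<Longrightarrow> rng G \<alpha> \<in> U \<Longrightarrow> src G \<alpha> \<in> U \<Longrightarrow> \<alpha> \<in> A"
proof -
  let ?\<phi> = "\<lambda>\<gamma>. (rng G \<gamma>, src G \<gamma>)"
  let ?UU = "prod_topology (units G) (units G)"
  obtain N U0 where N: "openin (units G) U0" "u \<in> U0" "U0 \<subseteq> N"
    "compactin (arrows G)
       (arrows G closure_of {\<gamma> \<in> topspace (arrows G). src G \<gamma> \<in> N \<and> rng G \<gamma> \<in> N})"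
    using bspec[OF ca[unfolded cartan_groupoid_def] u] by blast
  define L where "L = arrows G closure_of {\<gamma> \<in> topspace (arrows G). src G \<gamma> \<in> N \<and> rng G \<gamma> \<in> N}"
  have LN: "\<gamma> \<in> L" if "\<gamma> \<in> topspace (arrows G)" "src G \<gamma> \<in> N" "rng G \<gamma> \<in> N" for \<gamma>
    unfolding L_def using that
    by (intro subsetD[OF closure_of_subset]) auto
  have "closedin (arrows G) (L - A)"
    unfolding L_def using A by (intro closedin_diff) auto
  then have "compactin (arrows G) (L - A)"
    using N(4) unfolding L_def by (rule_tac closed_compactin) auto
  then have "compactin ?UU (?\<phi> ` (L - A))"
    using continuous_map_rng_src by (rule image_compactin)
  then have "closedin ?UU (?\<phi> ` (L - A))"
    using Hausdorff_units[OF hd]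
    by (intro compactin_imp_closedin) (simp_all add: Hausdorff_space_prod_topology)
  then have op: "openin ?UU (topspace ?UU - ?\<phi> ` (L - A))"
    by blast
  have "(u, u) \<notin> ?\<phi> ` (L - A)"
  proof
    assume "(u, u) \<in> ?\<phi> ` (L - A)"
    then obtain \<alpha> where \<alpha>: "\<alpha> \<in> L" "\<alpha> \<notin> A" "rng G \<alpha> = u" "src G \<alpha> = u" by auto
    then have "\<alpha> \<in> topspace (arrows G)"
      using N(4) compactin_subset_topspace unfolding L_def by blast
    then have "\<alpha> = ident G u"
      using pr \<alpha> u unfolding principal_groupoid_def
      by (metis ident_in_arrows rng_ident src_ident)
    with A \<alpha> show False by simp
  qed
  moreover have "(u, u) \<in> topspace ?UU"
    using u by simp
  ultimately have "(u, u) \<in> topspace ?UU - ?\<phi> ` (L - A)"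
    by blast
  with op obtain U1 U2 where U: "openin (units G) U1" "openin (units G) U2" "u \<in> U1" "u \<in> U2"
    "U1 \<times> U2 \<subseteq> topspace ?UU - ?\<phi> ` (L - A)"
    by (rule openin_prod_topologyE)
  show ?thesis
  proof
    show "openin (units G) (U0 \<inter> U1 \<inter> U2)"
      using N U by blast
    show "u \<in> U0 \<inter> U1 \<inter> U2"
      using N U by blast
    fix \<alpha> assume \<alpha>: "\<alpha> \<in> topspace (arrows G)"
      "rng G \<alpha> \<in> U0 \<inter> U1 \<inter> U2" "src G \<alpha> \<in> U0 \<inter> U1 \<inter> U2"
    then have "\<alpha> \<in> L"
      using LN N(3) by blast
    moreover have "?\<phi> \<alpha> \<notin> ?\<phi> ` (L - A)"
      using U(5) \<alpha> by blast
    ultimately show "\<alpha> \<in> A" by blast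
  qed
qed

text \<open>This is the continuity of multiplication at the composable pair \<open>(ident G (rng G \<gamma>), \<gamma>)\<close>, whose
  product is \<open>\<gamma>\<close>.\<close>

lemma cmp_near_ident:
  assumes W: "openin (arrows G) W" "\<gamma> \<in> W"
  obtains A B where "openin (arrows G) A" "openin (arrows G) B"
    "ident G (rng G \<gamma>) \<in> A" "\<gamma> \<in> B"
    "\<And>\<alpha> \<beta>. \<alpha> \<in> A \<Longrightarrow> \<beta> \<in> B \<Longrightarrow> src G \<alpha> = rng G \<beta> \<Longrightarrow> cmp G \<alpha> \<beta> \<in> W"
proof -
  let ?P = "prod_topology (arrows G) (arrows G)"
  have \<gamma>: "\<gamma> \<in> topspace (arrows G)"
    using W openin_subset by blast
  have "openin (subtopology ?P (composable G))
      {p \<in> topspace (subtopology ?P (composable G)). (case p of (\<alpha>, \<beta>) \<Rightarrow> cmp G \<alpha> \<beta>) \<in> W}"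
    using continuous_cmp W(1) by (rule openin_continuous_map_preimage)
  then obtain T where T: "openin ?P T"
    "{p \<in> topspace (subtopology ?P (composable G)). (case p of (\<alpha>, \<beta>) \<Rightarrow> cmp G \<alpha> \<beta>) \<in> W}
      = T \<inter> composable G"
    unfolding openin_subtopology by blast
  have i: "ident G (rng G \<gamma>) \<in> topspace (arrows G)"
    using \<gamma> by (simp add: ident_in_arrows rng_in_units)
  then have "(ident G (rng G \<gamma>), \<gamma>) \<in>
      {p \<in> topspace (subtopology ?P (composable G)). (case p of (\<alpha>, \<beta>) \<Rightarrow> cmp G \<alpha> \<beta>) \<in> W}"
    using \<gamma> W by (simp add: composable_def ident_cmp src_ident rng_in_units)
  then have "(ident G (rng G \<gamma>), \<gamma>) \<in> T"
    using T by blast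
  then obtain A B where AB: "openin (arrows G) A" "openin (arrows G) B"
    "ident G (rng G \<gamma>) \<in> A" "\<gamma> \<in> B" "A \<times> B \<subseteq> T"
    by (rule openin_prod_topologyE[OF T(1)]) blast
  show ?thesis
  proof (rule that[OF AB(1-4)])
    fix \<alpha> \<beta> assume \<alpha>\<beta>: "\<alpha> \<in> A" "\<beta> \<in> B" "src G \<alpha> = rng G \<beta>"
    then have "(\<alpha>, \<beta>) \<in> T \<inter> composable G"
      using AB openin_subset unfolding composable_def by blast
    then show "cmp G \<alpha> \<beta> \<in> W"
      unfolding T(2)[symmetric] by simp
  qed
qed

text \<open>
  Openness at an arbitrary \<open>\<gamma>\<close> is transported from openness at the unit arrow at its range: every
  \<open>\<delta>\<close> with ends near those of \<open>\<gamma>\<close> factors as an arrow near that unit times an arrow near \<open>\<gamma>\<close>.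
\<close>

lemma cartan_imp_open_map_rng_src:
  assumes hd: "Hausdorff_space (arrows G)" and pr: "principal_groupoid G"
    and ca: "cartan_groupoid G" and op: "open_map (arrows G) (units G) (rng G)"
  shows "open_map (arrows G) (arrows (kernel_groupoid (units G) (orbit G)))
    (\<lambda>\<gamma>. (rng G \<gamma>, src G \<gamma>))"
    (is "open_map _ (arrows ?R) ?\<phi>")
  unfolding open_map_def
proof (intro allI impI)
  fix W assume W: "openin (arrows G) W"
  have WG: "W \<subseteq> topspace (arrows G)"
    using W openin_subset by blast
  show "openin (arrows ?R) (?\<phi> ` W)"
  proof (subst openin_subopen, intro ballI)
    fix p assume "p \<in> ?\<phi> ` W"
    then obtain \<gamma> where \<gamma>: "\<gamma> \<in> W" "p = ?\<phi> \<gamma>" by blast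
    then have \<gamma>G: "\<gamma> \<in> topspace (arrows G)"
      using WG by blast
    obtain A B where AB: "openin (arrows G) A" "openin (arrows G) B"
      "ident G (rng G \<gamma>) \<in> A" "\<gamma> \<in> B"
      "\<And>\<alpha> \<beta>. \<alpha> \<in> A \<Longrightarrow> \<beta> \<in> B \<Longrightarrow> src G \<alpha> = rng G \<beta> \<Longrightarrow> cmp G \<alpha> \<beta> \<in> W"
      by (rule cmp_near_ident[OF W \<gamma>(1)]) blast
    obtain U where U: "openin (units G) U" "rng G \<gamma> \<in> U"
      "\<And>\<alpha>. \<alpha> \<in> topspace (arrows G) \<Longrightarrow> rng G \<alpha> \<in> U \<Longrightarrow> src G \<alpha> \<in> U \<Longrightarrow> \<alpha> \<in> A"
      by (rule arrow_near_ident[OF hd pr ca rng_in_units[OF \<gamma>G] AB(1,3)]) blast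
    \<comment> \<open>Cutting \<open>B\<close> down to ranges in \<open>U\<close> puts both ends of \<open>\<delta>\<beta>\<inverse>\<close> into \<open>U\<close>.\<close>
    define B' where "B' = {\<beta> \<in> B. rng G \<beta> \<in> U}"
    have B': "openin (arrows G) B'"
      unfolding B'_def using continuous_rng AB(2) U(1) by (rule openin_continuous_map_preimage_gen)
    then have V: "openin (units G) (src G ` B')"
      using open_map_src[OF op] by (simp add: open_map_def)
    have "openin (arrows ?R) (topspace (arrows ?R) \<inter> U \<times> (src G ` B'))"
    proof -
      have "openin (prod_topology (units G) (units G)) (U \<times> (src G ` B'))"
        using U(1) V by (simp add: openin_prod_Times_iff)
      then show ?thesis
        by (auto simp: kernel_groupoid_def openin_subtopology)
    qed
    moreover have "p \<in> topspace (arrows ?R) \<inter> U \<times> (src G ` B')"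
      using \<gamma> \<gamma>G U(2) AB(4) image_rng_src unfolding B'_def by blast
    moreover have "topspace (arrows ?R) \<inter> U \<times> (src G ` B') \<subseteq> ?\<phi> ` W"
    proof
      fix d assume d: "d \<in> topspace (arrows ?R) \<inter> U \<times> (src G ` B')"
      then have "d \<in> ?\<phi> ` topspace (arrows G)"
        using image_rng_src by blast
      then obtain \<delta> where \<delta>: "\<delta> \<in> topspace (arrows G)" "d = ?\<phi> \<delta>" by blast
      then obtain \<beta> where \<beta>: "\<beta> \<in> B'" "src G \<beta> = src G \<delta>" and r\<delta>: "rng G \<delta> \<in> U"
        using d by auto
      then have \<beta>G: "\<beta> \<in> topspace (arrows G)"
        using B' openin_subset by blast
      let ?\<alpha> = "cmp G \<delta> (invs G \<beta>)"
      have c: "(\<delta>, invs G \<beta>) \<in> composable G" "(invs G \<beta>, \<beta>) \<in> composable G"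
        using \<delta> \<beta> \<beta>G by (simp_all add: composable_def invs_in_arrows rng_invs src_invs)
      have s\<alpha>: "src G ?\<alpha> = rng G \<beta>"
        using src_cmp[OF c(1)] \<beta>G by (simp add: src_invs)
      then have "?\<alpha> \<in> A"
        using U(3)[OF cmp_in_arrows[OF c(1)]] rng_cmp[OF c(1)] r\<delta> \<beta>(1) by (simp add: B'_def)
      then have "cmp G ?\<alpha> \<beta> \<in> W"
        using AB(5) s\<alpha> \<beta>(1) by (simp add: B'_def)
      moreover have "cmp G ?\<alpha> \<beta> = \<delta>"
        using cmp_assoc[OF c] \<beta>G \<beta>(2) cmp_ident[OF \<delta>(1)] by (simp add: invs_cmp)
      ultimately show "d \<in> ?\<phi> ` W"
        using \<delta>(2) by (intro rev_image_eqI[of \<delta>]) simp_all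
    qed
    ultimately show "\<exists>T. openin (arrows ?R) T \<and> p \<in> T \<and> T \<subseteq> ?\<phi> ` W"
      by (intro exI conjI)
  qed
qed

text \<open>
  By injectivity, the arrows with both ends in a small neighbourhood of \<open>u\<close> all lie in a compact
  neighbourhood of the unit arrow at \<open>u\<close>, and compact sets are closed.
\<close>

lemma open_map_rng_src_imp_cartan:
  assumes lc: "locally_compact_space (arrows G)" and hd: "Hausdorff_space (arrows G)"
    and pr: "principal_groupoid G"
    and op: "open_map (arrows G) (arrows (kernel_groupoid (units G) (orbit G)))
      (\<lambda>\<gamma>. (rng G \<gamma>, src G \<gamma>))"
      (is "open_map _ (arrows ?R) ?\<phi>")
  shows "cartan_groupoid G"
  unfolding cartan_groupoid_def
proof
  fix u assume u: "u \<in> topspace (units G)"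
  obtain V K where V: "openin (arrows G) V" "compactin (arrows G) K" "ident G u \<in> V" "V \<subseteq> K"
    using lc ident_in_arrows[OF u] unfolding locally_compact_space_def by blast
  have "openin (arrows ?R) (?\<phi> ` V)"
    using op V by (simp add: open_map_def)
  then obtain T where T: "openin (prod_topology (units G) (units G)) T"
    "?\<phi> ` V = T \<inter> topspace (arrows ?R)"
    by (force simp: kernel_groupoid_def openin_subtopology)
  have "(u, u) \<in> ?\<phi> ` V"
    using V(3) u by (force simp: rng_ident src_ident intro!: rev_image_eqI[of "ident G u"])
  then have "(u, u) \<in> T"
    using T by blast
  then obtain U1 U2 where U: "openin (units G) U1" "openin (units G) U2" "u \<in> U1" "u \<in> U2"
    "U1 \<times> U2 \<subseteq> T"
    by (rule openin_prod_topologyE[OF T(1)]) blast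
  define N where "N = U1 \<inter> U2"
  have N: "openin (units G) N" "u \<in> N"
    using U unfolding N_def by auto
  have "{\<gamma> \<in> topspace (arrows G). src G \<gamma> \<in> N \<and> rng G \<gamma> \<in> N} \<subseteq> K"
  proof
    fix \<gamma> assume \<gamma>: "\<gamma> \<in> {\<gamma> \<in> topspace (arrows G). src G \<gamma> \<in> N \<and> rng G \<gamma> \<in> N}"
    then have "?\<phi> \<gamma> \<in> T \<inter> topspace (arrows ?R)"
      using U(5) image_rng_src unfolding N_def by blast
    then obtain \<beta> where "\<beta> \<in> V" "?\<phi> \<gamma> = ?\<phi> \<beta>"
      using T(2) by blast
    moreover have "\<beta> \<in> topspace (arrows G)"
      using V(1) openin_subset \<open>\<beta> \<in> V\<close> by blast
    ultimately have "\<gamma> = \<beta>"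
      using pr \<gamma> unfolding principal_groupoid_def by blast
    with \<open>\<beta> \<in> V\<close> V(4) show "\<gamma> \<in> K" by blast
  qed
  then have "arrows G closure_of {\<gamma> \<in> topspace (arrows G). src G \<gamma> \<in> N \<and> rng G \<gamma> \<in> N} \<subseteq> K"
    using hd V(2) by (intro closure_of_minimal compactin_imp_closedin)
  then have "compactin (arrows G)
      (arrows G closure_of {\<gamma> \<in> topspace (arrows G). src G \<gamma> \<in> N \<and> rng G \<gamma> \<in> N})"
    using V(2) by (rule_tac closed_compactin) auto
  then show "\<exists>N\<subseteq>topspace (units G). (\<exists>U. openin (units G) U \<and> u \<in> U \<and> U \<subseteq> N) \<and>
      compactin (arrows G)
        (arrows G closure_of {\<gamma> \<in> topspace (arrows G). src G \<gamma> \<in> N \<and> rng G \<gamma> \<in> N})"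
    using N openin_subset by blast
qed

end

theorem proposition4p5:
  fixes G :: "('a, 'u) groupoid_data"
  assumes "topological_groupoid G"
    and "locally_compact_space (arrows G)"
    and "Hausdorff_space (arrows G)"
    and "principal_groupoid G"
    and "\<exists>\<mu>. haar_system G \<mu>"
  shows "cartan_groupoid G \<longleftrightarrow>
    topological_groupoid_iso G (kernel_groupoid (units G) (orbit G)) (\<lambda>\<gamma>. (rng G \<gamma>, src G \<gamma>))"
proof -
  interpret topological_groupoid G by fact
  let ?R = "kernel_groupoid (units G) (orbit G)" and ?\<phi> = "\<lambda>\<gamma>. (rng G \<gamma>, src G \<gamma>)"
  have rng_open: "open_map (arrows G) (units G) (rng G)"
    using assms haar_system_imp_open_map_rng by blast
  have "continuous_map (arrows G) (arrows ?R) ?\<phi>"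
  proof -
    have "?\<phi> \<in> topspace (arrows G) \<rightarrow> topspace (arrows ?R)"
      using image_rng_src by blast
    with continuous_map_rng_src
    have "continuous_map (arrows G)
        (subtopology (prod_topology (units G) (units G)) (topspace (arrows ?R))) ?\<phi>"
      by (rule continuous_map_into_subtopology)
    moreover have "subtopology (prod_topology (units G) (units G)) (topspace (arrows ?R)) = arrows ?R"
      by (simp add: kernel_groupoid_def) (auto intro: arg_cong[where f = "subtopology _"])
    ultimately show ?thesis by simp
  qed
  moreover have "inj_on ?\<phi> (topspace (arrows G))"
    using assms(4) unfolding principal_groupoid_def inj_on_def by blast
  ultimately have "homeomorphic_map (arrows G) (arrows ?R) ?\<phi> \<longleftrightarrow> open_map (arrows G) (arrows ?R) ?\<phi>"
    using bijective_open_imp_homeomorphic_map[OF _ _ image_rng_src] homeomorphic_imp_open_map by blast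
  moreover have "cartan_groupoid G \<longleftrightarrow> open_map (arrows G) (arrows ?R) ?\<phi>"
    using cartan_imp_open_map_rng_src open_map_rng_src_imp_cartan assms(2-4) rng_open by blast
  ultimately show ?thesis
    by (simp add: topological_groupoid_iso_rng_src_iff)
qed

end
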